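(* The double-confluent Heun equation $$u''(x)+\left(\frac{\sqrt2}{x^2}+\frac{1+\alpha}{2x}-\frac{\sqrt2\,t}{2}\right)u'(x)+\frac{\sqrt2\,t(2n+\alpha)}{8x}\,u(x)=0$$ can be transformed (by the method of isomonodromic deformations with respect to $t$) into a Painlevé III$'$ equation.
   Context: Here $n$ is a positive integer (the degree of an orthogonal polynomial), and $\alpha>0$, $t>0$ are parameters. The equation arises from the polynomials orthogonal with respect to the weight $|x|^{\alpha}\exp(-x^2-t/x^2)$ on $\mathbb R$. "Transformed" refers to the following method of isomonodromic deformations. Write the equation as $\sigma u''+\tau u'+\eta u=0$ with $\sigma,\tau,\eta$ polynomials in $x$ that may depend on $t$. Introduce additional parameters $\lambda,\mu$ with $\sigma(\lambda)\ne0$, and the deformed equation $$\sigma(x)\varphi''+\left(\tau(x)-\frac{\sigma(x)}{x-\lambda}\right)\varphi'+\left(\eta(x)-\eta(\lambda)-\mu\big(\tau(\lambda)-\sigma'(\lambda)\big)-\mu^2\sigma(\lambda)+\frac{\mu\,\sigma(\lambda)}{x-\lambda}\right)\varphi=0,$$ which has an additional non-logarithmic singularity at $x=\lambda$. Let $\lambda,\mu$ depend on $t$ and require the deformed equation to be compatible with an equation $\partial_t\varphi=a(x,t)\,\partial_x\varphi+b(x,t)\,\varphi$ for suitable compatibility functions $a,b$. This compatibility is expressed by a Hamiltonian system $\dot\lambda=\partial H/\partial\mu$, $\dot\mu=-\partial H/\partial\lambda$. Eliminating $\mu$ gives a second order equation for $\lambda$, which is to be a Painlevé equation, possibly after a change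 of variables. The Painlevé III$'$ equation with parameters $(A,B,C,D)$ is $$\frac{d^2y}{dt^2}=\frac1y\left(\frac{dy}{dt}\right)^2-\frac1t\frac{dy}{dt}+\frac{A y^2}{4t^2}+\frac{B}{4t}+\frac{C y^3}{4t^2}+\frac{D}{4y}.$$ *)

theory Defs
  imports "HOL-Complex_Analysis.Complex_Analysis" "HOL-Computational_Algebra.Polynomial"
begin

text \<open>Conventions: the deformation parameter \<open>t\<close> is a positive real; the independent variable
  \<open>x\<close>, the parameters \<open>\<lambda>\<close>, \<open>\<mu>\<close> (written \<open>l\<close>, \<open>m\<close> as values, \<open>lam\<close>, \<open>mu\<close> as functions of \<open>t\<close>)
  and all dependent variables are complex.\<close>

text \<open>The double-confluent Heun equation, given by its coefficients:
  \<open>u'' + heun_p \<alpha> t x * u' + heun_q n \<alpha> t x * u = 0\<close>.\<close>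

definition heun_p :: "real \<Rightarrow> real \<Rightarrow> complex \<Rightarrow> complex" where
  "heun_p \<alpha> t x = of_real (sqrt 2) / x\<^sup>2 + of_real (1 + \<alpha>) / (2 * x) - of_real (sqrt 2 * t / 2)"

definition heun_q :: "nat \<Rightarrow> real \<Rightarrow> real \<Rightarrow> complex \<Rightarrow> complex" where
  "heun_q n \<alpha> t x = of_real (sqrt 2 * t * (2 * real n + \<alpha>)) / (8 * x)"

text \<open>\<open>u'' + p u' + q u = 0\<close> written as \<open>\<sigma> u'' + \<tau> u' + \<eta> u = 0\<close> with polynomials in \<open>x\<close>.
  The last condition says that denominators are cleared without a superfluous common factor.\<close>

definition polynomial_form ::
  "(real \<Rightarrow> complex \<Rightarrow> complex) \<Rightarrow> (real \<Rightarrow> complex \<Rightarrow> complex) \<Rightarrow>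
   (real \<Rightarrow> complex poly) \<Rightarrow> (real \<Rightarrow> complex poly) \<Rightarrow> (real \<Rightarrow> complex poly) \<Rightarrow> bool" where
  "polynomial_form p q \<sigma> \<tau> \<eta> \<longleftrightarrow>
     (\<forall>t>0. \<sigma> t \<noteq> 0 \<and>
        (\<forall>x. poly (\<sigma> t) x \<noteq> 0 \<longrightarrow>
           p t x = poly (\<tau> t) x / poly (\<sigma> t) x \<and> q t x = poly (\<eta> t) x / poly (\<sigma> t) x) \<and>
        (\<nexists>x. poly (\<sigma> t) x = 0 \<and> poly (\<tau> t) x = 0 \<and> poly (\<eta> t) x = 0))"

text \<open>Coefficients of the deformed equation \<open>\<phi>'' + P \<phi>' + Q \<phi> = 0\<close>, divided by \<open>\<sigma>\<close>.\<close>

definition deformed_P ::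
  "(real \<Rightarrow> complex poly) \<Rightarrow> (real \<Rightarrow> complex poly) \<Rightarrow> real \<Rightarrow> complex \<Rightarrow> complex \<Rightarrow> complex" where
  "deformed_P \<sigma> \<tau> t l x =
     (poly (\<tau> t) x - poly (\<sigma> t) x / (x - l)) / poly (\<sigma> t) x"

definition deformed_Q ::
  "(real \<Rightarrow> complex poly) \<Rightarrow> (real \<Rightarrow> complex poly) \<Rightarrow> (real \<Rightarrow> complex poly) \<Rightarrow>
   real \<Rightarrow> complex \<Rightarrow> complex \<Rightarrow> complex \<Rightarrow> complex" where
  "deformed_Q \<sigma> \<tau> \<eta> t l m x =
     (poly (\<eta> t) x - poly (\<eta> t) l - m * (poly (\<tau> t) l - poly (pderiv (\<sigma> t)) l)
        - m\<^sup>2 * poly (\<sigma> t) l + m * poly (\<sigma> t) l / (x - l)) / poly (\<sigma> t) x"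

text \<open>A pair \<open>(f, g)\<close> stands for the expression \<open>f \<phi> + g \<phi>\<^sub>x\<close>; \<open>total_dx P Q\<close> is its \<open>x\<close>-derivative
  reduced by means of \<open>\<phi>\<^sub>x\<^sub>x = - P \<phi>\<^sub>x - Q \<phi>\<close>.\<close>

definition total_dx ::
  "(complex \<Rightarrow> complex) \<Rightarrow> (complex \<Rightarrow> complex) \<Rightarrow>
   (complex \<Rightarrow> complex) \<times> (complex \<Rightarrow> complex) \<Rightarrow> (complex \<Rightarrow> complex) \<times> (complex \<Rightarrow> complex)" where
  "total_dx P Q = (\<lambda>(f, g).
     (\<lambda>x. deriv f x - Q x * g x, \<lambda>x. f x + deriv g x - P x * g x))"

text \<open>Compatibility of \<open>\<phi>\<^sub>x\<^sub>x = - P \<phi>\<^sub>x - Q \<phi>\<close> with \<open>\<phi>\<^sub>t = a \<phi>\<^sub>x + b \<phi>\<close> at time \<open>t\<close>, for \<open>x\<close> in \<open>S\<close>: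
  \<open>(\<phi>\<^sub>t)\<^sub>x\<^sub>x\<close> and \<open>(- P \<phi>\<^sub>x - Q \<phi>)\<^sub>t = - P\<^sub>t \<phi>\<^sub>x - P \<phi>\<^sub>t\<^sub>x - Q\<^sub>t \<phi> - Q \<phi>\<^sub>t\<close>, both reduced to combinations of
  \<open>\<phi>\<close> and \<open>\<phi>\<^sub>x\<close>, have the same coefficients.\<close>

definition compatible_at ::
  "(real \<Rightarrow> complex \<Rightarrow> complex) \<Rightarrow> (real \<Rightarrow> complex \<Rightarrow> complex) \<Rightarrow>
   (complex \<Rightarrow> complex) \<Rightarrow> (complex \<Rightarrow> complex) \<Rightarrow> real \<Rightarrow> complex set \<Rightarrow> bool" where
  "compatible_at P Q a b t S \<longleftrightarrow>
     (\<forall>x\<in>S. \<exists>Pt Qt.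
        ((\<lambda>s. P s x) has_vector_derivative Pt) (at t) \<and>
        ((\<lambda>s. Q s x) has_vector_derivative Qt) (at t) \<and>
        (let \<phi>_t = (b, a);
             \<phi>_tx = total_dx (P t) (Q t) \<phi>_t;
             \<phi>_txx = total_dx (P t) (Q t) \<phi>_tx
         in fst \<phi>_txx x = - P t x * fst \<phi>_tx x - Qt - Q t x * fst \<phi>_t x \<and>
            snd \<phi>_txx x = - Pt - P t x * snd \<phi>_tx x - Q t x * snd \<phi>_t x))"

text \<open>Compatibility functions are written as functions of \<open>t\<close>, \<open>\<lambda>\<close>, \<open>\<mu>\<close> and \<open>x\<close>. They are rational in
  \<open>x\<close>, with poles only at the singular points of the deformed equation.\<close>

definition compatibility_function ::
  "(real \<Rightarrow> complex poly) \<Rightarrow> (real \<Rightarrow> complex \<Rightarrow> complex \<Rightarrow> complex \<Rightarrow> complex) \<Rightarrow> bool" where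
  "compatibility_function \<sigma> a \<longleftrightarrow>
     (\<forall>t>0. \<forall>l m. poly (\<sigma> t) l \<noteq> 0 \<longrightarrow>
        (\<exists>u v. \<forall>x. poly (\<sigma> t) x \<noteq> 0 \<and> x \<noteq> l \<longrightarrow> poly v x \<noteq> 0 \<and> a t l m x = poly u x / poly v x))"

definition isomonodromic_on ::
  "(real \<Rightarrow> complex poly) \<Rightarrow> (real \<Rightarrow> complex poly) \<Rightarrow> (real \<Rightarrow> complex poly) \<Rightarrow>
   (real \<Rightarrow> complex \<Rightarrow> complex \<Rightarrow> complex \<Rightarrow> complex) \<Rightarrow>
   (real \<Rightarrow> complex \<Rightarrow> complex \<Rightarrow> complex \<Rightarrow> complex) \<Rightarrow>
   real set \<Rightarrow> (real \<Rightarrow> complex) \<Rightarrow> (real \<Rightarrow> complex) \<Rightarrow> bool" where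
  "isomonodromic_on \<sigma> \<tau> \<eta> a b I lam mu \<longleftrightarrow>
     (\<forall>t\<in>I. compatible_at
        (\<lambda>s. deformed_P \<sigma> \<tau> s (lam s)) (\<lambda>s. deformed_Q \<sigma> \<tau> \<eta> s (lam s) (mu s))
        (a t (lam t) (mu t)) (b t (lam t) (mu t)) t
        {x. poly (\<sigma> t) x \<noteq> 0 \<and> x \<noteq> lam t})"

definition hamiltonian_function ::
  "(real \<Rightarrow> complex poly) \<Rightarrow> (real \<Rightarrow> complex \<Rightarrow> complex \<Rightarrow> complex) \<Rightarrow> bool" where
  "hamiltonian_function \<sigma> H \<longleftrightarrow>
     (\<forall>t>0. \<forall>l m. poly (\<sigma> t) l \<noteq> 0 \<longrightarrow>
        (\<lambda>l'. H t l' m) field_differentiable (at l) \<and>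
        (\<lambda>m'. H t l m') field_differentiable (at m))"

definition hamiltonian_system_on ::
  "(real \<Rightarrow> complex \<Rightarrow> complex \<Rightarrow> complex) \<Rightarrow> real set \<Rightarrow>
   (real \<Rightarrow> complex) \<Rightarrow> (real \<Rightarrow> complex) \<Rightarrow> bool" where
  "hamiltonian_system_on H I lam mu \<longleftrightarrow>
     (\<forall>t\<in>I. (lam has_vector_derivative deriv (\<lambda>m. H t (lam t) m) (mu t)) (at t) \<and>
            (mu has_vector_derivative - deriv (\<lambda>l. H t l (mu t)) (lam t)) (at t))"

definition solves_second_order_on ::
  "(real \<Rightarrow> complex \<Rightarrow> complex \<Rightarrow> complex) \<Rightarrow> real set \<Rightarrow> (real \<Rightarrow> complex) \<Rightarrow> bool" where
  "solves_second_order_on R I y \<longleftrightarrow>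
     (\<exists>y'. \<forall>t\<in>I. (y has_vector_derivative y' t) (at t) \<and>
                 (y' has_vector_derivative R t (y t) (y' t)) (at t))"

definition painleve_III'_on ::
  "complex \<Rightarrow> complex \<Rightarrow> complex \<Rightarrow> complex \<Rightarrow> real set \<Rightarrow> (real \<Rightarrow> complex) \<Rightarrow> bool" where
  "painleve_III'_on A B C D I y \<longleftrightarrow>
     (\<forall>t\<in>I. y t \<noteq> 0) \<and>
     solves_second_order_on
       (\<lambda>t y y'. y'\<^sup>2 / y - y' / of_real t + A * y\<^sup>2 / (4 * (of_real t)\<^sup>2) + B / (4 * of_real t)
          + C * y ^ 3 / (4 * (of_real t)\<^sup>2) + D / (4 * y)) I y"

text \<open>A change of variables \<open>s = \<psi>(t)\<close>, \<open>y(s) = Y(t, \<lambda>(t))\<close>, invertible in both variables; \<open>Y t\<close> maps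
  the admissible values of \<open>\<lambda>\<close> onto the nonzero values admitted for Painleve III'.\<close>

definition change_of_variables ::
  "(real \<Rightarrow> complex poly) \<Rightarrow> (real \<Rightarrow> real) \<Rightarrow> (real \<Rightarrow> complex \<Rightarrow> complex) \<Rightarrow> bool" where
  "change_of_variables \<sigma> \<psi> Y \<longleftrightarrow>
     bij_betw \<psi> {0<..} {0<..} \<and>
     (\<forall>t>0. \<exists>d. d \<noteq> 0 \<and> (\<psi> has_real_derivative d) (at t)) \<and>
     (\<lambda>(t, l). Y t l) differentiable_on {(t, l). t > 0 \<and> poly (\<sigma> t) l \<noteq> 0} \<and>
     (\<forall>t>0. Y t holomorphic_on {l. poly (\<sigma> t) l \<noteq> 0} \<and>
            bij_betw (Y t) {l. poly (\<sigma> t) l \<noteq> 0} (- {0}))"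

definition admissible_on ::
  "(real \<Rightarrow> complex poly) \<Rightarrow> real set \<Rightarrow> (real \<Rightarrow> complex) \<Rightarrow> bool" where
  "admissible_on \<sigma> I lam \<longleftrightarrow> open I \<and> I \<subseteq> {0<..} \<and> (\<forall>t\<in>I. poly (\<sigma> t) (lam t) \<noteq> 0)"

text \<open>The method of isomonodromic deformations with respect to \<open>t\<close>: compatibility of the deformed
  equation is expressed by a Hamiltonian system; eliminating \<open>\<mu>\<close> from that system gives a second
  order equation (with right-hand side \<open>R\<close>) for \<open>\<lambda>\<close>; a change of variables turns this equation into
  Painleve III' with constant parameters. Each step is an equivalence on solutions.\<close>

definition transforms_to_painleve_III' ::
  "(real \<Rightarrow> complex \<Rightarrow> complex) \<Rightarrow> (real \<Rightarrow> complex \<Rightarrow> complex) \<Rightarrow> bool" where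
  "transforms_to_painleve_III' p q \<longleftrightarrow>
     (\<exists>\<sigma> \<tau> \<eta> a b H R \<psi> Y A B C D.
        polynomial_form p q \<sigma> \<tau> \<eta> \<and>
        compatibility_function \<sigma> a \<and> compatibility_function \<sigma> b \<and>
        hamiltonian_function \<sigma> H \<and>
        change_of_variables \<sigma> \<psi> Y \<and>
        (\<forall>I lam mu. admissible_on \<sigma> I lam \<longrightarrow>
           (\<forall>t\<in>I. lam differentiable (at t) \<and> mu differentiable (at t)) \<longrightarrow>
           (isomonodromic_on \<sigma> \<tau> \<eta> a b I lam mu \<longleftrightarrow> hamiltonian_system_on H I lam mu)) \<and>
        (\<forall>I lam. admissible_on \<sigma> I lam \<longrightarrow>
           ((\<exists>mu. hamiltonian_system_on H I lam mu) \<longleftrightarrow> solves_second_order_on R I lam)) \<and>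
        (\<forall>I lam y. admissible_on \<sigma> I lam \<longrightarrow> (\<forall>t\<in>I. y (\<psi> t) = Y t (lam t)) \<longrightarrow>
           (solves_second_order_on R I lam \<longleftrightarrow> painleve_III'_on A B C D (\<psi> ` I) y)))"

end

theory Submission
  imports Defs
begin

text \<open>
Write \<open>s = sqrt 2\<close>, \<open>\<beta> = (1 + \<alpha>) / 2\<close>, \<open>\<nu> = (2 n + \<alpha>) / 4\<close> and \<open>\<gamma> = s t / 2\<close>.  The equation is then
\<open>x\<^sup>2 u'' + (s + \<beta> x - \<gamma> x\<^sup>2) u' + \<nu> \<gamma> x u = 0\<close>, and everything below works for arbitrary complex
\<open>s \<noteq> 0\<close>, \<open>\<beta>\<close>, \<open>\<nu>\<close>.

The choice of \<open>a\<close> is forced by the local behaviour of solutions.  Near infinity the ratio of two solutions behaves like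
\<open>exp (\<gamma> x)\<close> with \<open>\<gamma>\<close> proportional to \<open>t\<close>, so \<open>a\<close> must behave like \<open>x / t\<close>; near \<open>0\<close> it behaves like
\<open>exp (s / x)\<close> with \<open>s\<close> constant, so \<open>a\<close> must vanish to second order; a simple pole at \<open>x = \<lambda>\<close> lets the
apparent singularity move.  This gives \<open>a = x\<^sup>2 / (t (x - \<lambda>))\<close>.  For given \<open>\<lambda>'\<close>, the \<open>\<phi>\<^sub>x\<close>-part of the
compatibility condition determines \<open>b\<close> up to a function of \<open>t\<close>; for the Hamiltonian value of \<open>\<lambda>'\<close> one solution is
\<open>b = - \<mu> \<lambda>\<^sup>2 / (t (x - \<lambda>))\<close>.

With these \<open>a\<close>, \<open>b\<close> the first compatibility equation reduces to the defect of Hamilton's equation for \<open>\<lambda>'\<close>, and, once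
that vanishes, the second one to a multiple of the defect of the equation for \<open>\<mu>'\<close> (\<open>zero_curvature_phi_x\<close>,
\<open>zero_curvature_phi\<close>).  The Hamiltonian is, up to the factor \<open>1 / t\<close>, the quantity subtracted from \<open>\<eta>(x)\<close> in the
deformed equation:
\<open>t H = \<mu>\<^sup>2 \<lambda>\<^sup>2 + \<mu> (\<tau>(\<lambda>) - \<sigma>'(\<lambda>)) + \<eta>(\<lambda>)\<close>.

It is quadratic in \<open>\<mu>\<close> with leading coefficient \<open>\<lambda>\<^sup>2 / t \<noteq> 0\<close>, so \<open>\<lambda>'\<close> is an affine bijective function of \<open>\<mu>\<close>,
and \<open>\<mu>\<close> can be eliminated without loss
(\<open>velocity_derivative\<close>, \<open>momentum_from_velocity\<close>).  In terms of \<open>\<theta> = t d/dt\<close> the result reads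
\<open>\<theta>\<^sup>2 log \<lambda> = \<gamma>\<^sup>2 \<lambda>\<^sup>2 - s\<^sup>2 / \<lambda>\<^sup>2 + (2 - \<beta>) s / \<lambda> + (1 - \<beta> - 2 \<nu>) \<gamma> \<lambda>\<close>.  Because \<open>\<theta>\<^sup>2 log t = 0\<close>, the
substitution \<open>y = t \<lambda>\<close> leaves the left-hand side alone and turns the right-hand side into that of Painleve III' with
\<open>(A, B, C, D) = (2 s (1 - \<beta> - 2 \<nu>), 4 s (2 - \<beta>), s\<^sup>2, - 4 s\<^sup>2)\<close>; for the equation at hand these are
\<open>(sqrt 2 (1 - 2 \<alpha> - 2 n), 2 sqrt 2 (3 - \<alpha>), 2, - 8)\<close>.
\<close>

section \<open>Calculus of complex-valued functions of a real variable\<close>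

lemma has_vector_derivative_divide:
  fixes f g :: "real \<Rightarrow> complex"
  assumes "(f has_vector_derivative f') (at t)" and "(g has_vector_derivative g') (at t)"
    and "g t \<noteq> 0"
  shows "((\<lambda>s. f s / g s) has_vector_derivative (f' * g t - f t * g') / (g t)\<^sup>2) (at t)"
proof -
  have "((\<lambda>s. f s / g s) has_derivative
      (\<lambda>h. - f t * (inverse (g t) * (h *\<^sub>R g') * inverse (g t)) + h *\<^sub>R f' / g t)) (at t)"
    using assms(1,2)[unfolded has_vector_derivative_def] assms(3) by (rule has_derivative_divide)
  moreover have "(\<lambda>h. - f t * (inverse (g t) * (h *\<^sub>R g') * inverse (g t)) + h *\<^sub>R f' / g t) =
      (\<lambda>h. h *\<^sub>R ((f' * g t - f t * g') / (g t)\<^sup>2))"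
    using assms(3) by (auto simp: field_simps power2_eq_square scaleR_conv_of_real)
  ultimately show ?thesis
    unfolding has_vector_derivative_def by metis
qed

lemma has_vector_derivative_power2:
  fixes f :: "real \<Rightarrow> complex"
  assumes "(f has_vector_derivative f') (at t)"
  shows "((\<lambda>s. (f s)\<^sup>2) has_vector_derivative 2 * f t * f') (at t)"
  using has_vector_derivative_mult[OF assms assms] by (simp add: power2_eq_square algebra_simps)

lemma has_vector_derivative_complex_of_real:
  "(complex_of_real has_vector_derivative 1) (at t)"
  using has_vector_derivative_of_real[OF DERIV_ident] by simp

lemmas vector_derivative_rules =
  has_vector_derivative_add has_vector_derivative_diff has_vector_derivative_minus
  has_vector_derivative_mult has_vector_derivative_divide has_vector_derivative_power2
  has_vector_derivative_const has_vector_derivative_complex_of_real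

section \<open>Compatibility as two scalar equations\<close>

text \<open>Reducing \<open>\<phi>\<^sub>t\<^sub>x\<^sub>x\<close> by the differential equation, all terms containing \<open>P Q\<close>, \<open>P\<^sup>2\<close> or \<open>Q b\<close>
  occur on both sides, and what is left is the usual pair of equations for \<open>a\<close> and \<open>b\<close>.  The derivatives are
  passed as functions on an open set because the iterated use of \<open>deriv\<close> needs the first derivatives on a whole
  neighbourhood of each point.\<close>

lemma compatible_at_iff:
  assumes "open S"
    and a: "\<And>x. x \<in> S \<Longrightarrow> (a has_field_derivative a' x) (at x)"
      "\<And>x. x \<in> S \<Longrightarrow> (a' has_field_derivative a'' x) (at x)"
    and b: "\<And>x. x \<in> S \<Longrightarrow> (b has_field_derivative b' x) (at x)"
      "\<And>x. x \<in> S \<Longrightarrow> (b' has_field_derivative b'' x) (at x)"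
    and P: "\<And>x. x \<in> S \<Longrightarrow> (P t has_field_derivative P' x) (at x)"
      "\<And>x. x \<in> S \<Longrightarrow> ((\<lambda>s. P s x) has_vector_derivative Pt x) (at t)"
    and Q: "\<And>x. x \<in> S \<Longrightarrow> (Q t has_field_derivative Q' x) (at x)"
      "\<And>x. x \<in> S \<Longrightarrow> ((\<lambda>s. Q s x) has_vector_derivative Qt x) (at t)"
  shows "compatible_at P Q a b t S \<longleftrightarrow>
    (\<forall>x\<in>S. 2 * b' x + a'' x - P' x * a x - P t x * a' x + Pt x = 0 \<and>
           b'' x - Q' x * a x - 2 * Q t x * a' x + P t x * b' x + Qt x = 0)"
proof -
  define f1 where "f1 = (\<lambda>x. b' x - Q t x * a x)"
  define g1 where "g1 = (\<lambda>x. b x + a' x - P t x * a x)"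
  have eq1: "deriv b x - Q t x * a x = f1 x" "b x + deriv a x - P t x * a x = g1 x"
    if "x \<in> S" for x
    using DERIV_imp_deriv[OF a(1)[OF that]] DERIV_imp_deriv[OF b(1)[OF that]]
    by (auto simp: f1_def g1_def)
  have df1: "((\<lambda>x. deriv b x - Q t x * a x) has_field_derivative
      b'' x - (Q' x * a x + Q t x * a' x)) (at x)" if "x \<in> S" for x
  proof (rule has_field_derivative_transform_within_open[OF _ \<open>open S\<close> that])
    show "(f1 has_field_derivative b'' x - (Q' x * a x + Q t x * a' x)) (at x)"
      unfolding f1_def using a(1)[OF that] b(2)[OF that] Q(1)[OF that]
      by (auto intro!: derivative_eq_intros)
  qed (simp add: eq1)
  have dg1: "((\<lambda>x. b x + deriv a x - P t x * a x) has_field_derivative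
      b' x + a'' x - (P' x * a x + P t x * a' x)) (at x)" if "x \<in> S" for x
  proof (rule has_field_derivative_transform_within_open[OF _ \<open>open S\<close> that])
    show "(g1 has_field_derivative b' x + a'' x - (P' x * a x + P t x * a' x)) (at x)"
      unfolding g1_def using a[OF that] b(1)[OF that] P(1)[OF that]
      by (auto intro!: derivative_eq_intros)
  qed (simp add: eq1)
  have unique: "(\<exists>p q. ((\<lambda>s. P s x) has_vector_derivative p) (at t) \<and>
      ((\<lambda>s. Q s x) has_vector_derivative q) (at t) \<and> F p q) \<longleftrightarrow> F (Pt x) (Qt x)"
    if "x \<in> S" for x F
    using P(2)[OF that] Q(2)[OF that] vector_derivative_unique_at by metis
  show ?thesis
    unfolding compatible_at_def Let_def total_dx_def prod.case fst_conv snd_conv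
  proof (intro ball_cong refl, subst unique, assumption)
    fix x assume x: "x \<in> S"
    show "(deriv (\<lambda>x. deriv b x - Q t x * a x) x - Q t x * (b x + deriv a x - P t x * a x) =
          - P t x * (deriv b x - Q t x * a x) - Qt x - Q t x * b x \<and>
        deriv b x - Q t x * a x + deriv (\<lambda>x. b x + deriv a x - P t x * a x) x
          - P t x * (b x + deriv a x - P t x * a x) =
          - Pt x - P t x * (b x + deriv a x - P t x * a x) - Q t x * a x) \<longleftrightarrow>
      (2 * b' x + a'' x - P' x * a x - P t x * a' x + Pt x = 0 \<and>
           b'' x - Q' x * a x - 2 * Q t x * a' x + P t x * b' x + Qt x = 0)"
      unfolding DERIV_imp_deriv[OF df1[OF x]] DERIV_imp_deriv[OF dg1[OF x]]
        DERIV_imp_deriv[OF a(1)[OF x]] DERIV_imp_deriv[OF b(1)[OF x]]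
      by (auto simp: algebra_simps eq_neg_iff_add_eq_0)
  qed
qed

section \<open>The deformed equation and its Hamiltonian system\<close>

text \<open>The singularity at \<open>0\<close> is irregular only if \<open>s \<noteq> 0\<close>; for \<open>s = 0\<close> the polynomials below would have the
  common root \<open>0\<close>.\<close>

locale double_confluent =
  fixes s \<beta> \<nu> :: complex
  assumes s_nonzero: "s \<noteq> 0"
begin

abbreviation \<gamma> :: "real \<Rightarrow> complex" where
  "\<gamma> t \<equiv> s * of_real t / 2"

definition \<sigma> :: "real \<Rightarrow> complex poly" where
  "\<sigma> t = [:0, 0, 1:]"

definition \<tau> :: "real \<Rightarrow> complex poly" where
  "\<tau> t = [:s, \<beta>, - \<gamma> t:]"

definition \<eta> :: "real \<Rightarrow> complex poly" where
  "\<eta> t = [:0, \<nu> * \<gamma> t:]"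

definition a :: "real \<Rightarrow> complex \<Rightarrow> complex \<Rightarrow> complex \<Rightarrow> complex" where
  "a t l m x = x\<^sup>2 / (of_real t * (x - l))"

definition b :: "real \<Rightarrow> complex \<Rightarrow> complex \<Rightarrow> complex \<Rightarrow> complex" where
  "b t l m x = - (m * l\<^sup>2) / (of_real t * (x - l))"

definition H :: "real \<Rightarrow> complex \<Rightarrow> complex \<Rightarrow> complex" where
  "H t l m = (m\<^sup>2 * l\<^sup>2 + m * (s + (\<beta> - 2) * l - \<gamma> t * l\<^sup>2) + \<nu> * \<gamma> t * l) / of_real t"

definition H\<^sub>m :: "real \<Rightarrow> complex \<Rightarrow> complex \<Rightarrow> complex" where
  "H\<^sub>m t l m = (2 * m * l\<^sup>2 + (s + (\<beta> - 2) * l - \<gamma> t * l\<^sup>2)) / of_real t"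

definition H\<^sub>l :: "real \<Rightarrow> complex \<Rightarrow> complex \<Rightarrow> complex" where
  "H\<^sub>l t l m = (2 * m\<^sup>2 * l + m * (\<beta> - 2 - 2 * \<gamma> t * l) + \<nu> * \<gamma> t) / of_real t"

text \<open>This is \<open>\<theta>\<^sup>2 log \<lambda> = \<gamma>\<^sup>2 \<lambda>\<^sup>2 - s\<^sup>2 / \<lambda>\<^sup>2 + (2 - \<beta>) s / \<lambda> + (1 - \<beta> - 2 \<nu>) \<gamma> \<lambda>\<close>, where \<open>\<theta> = t d/dt\<close>,
  solved for the second derivative of \<open>\<lambda>\<close>.\<close>

definition R :: "real \<Rightarrow> complex \<Rightarrow> complex \<Rightarrow> complex" where
  "R t l p = p\<^sup>2 / l - p / of_real t +
     ((\<gamma> t)\<^sup>2 * l ^ 3 - s\<^sup>2 / l + (2 - \<beta>) * s + (1 - \<beta> - 2 * \<nu>) * \<gamma> t * l\<^sup>2) / (of_real t)\<^sup>2"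

lemma poly_sigma [simp]: "poly (\<sigma> t) x = x\<^sup>2" "poly (pderiv (\<sigma> t)) x = 2 * x"
  by (simp_all add: \<sigma>_def pderiv_pCons power2_eq_square)

lemma poly_tau [simp]: "poly (\<tau> t) x = s + \<beta> * x - \<gamma> t * x\<^sup>2"
  by (simp add: \<tau>_def power2_eq_square algebra_simps)

lemma poly_eta [simp]: "poly (\<eta> t) x = \<nu> * \<gamma> t * x"
  by (simp add: \<eta>_def algebra_simps)

lemma H_partial_m: "((\<lambda>m. H t l m) has_field_derivative H\<^sub>m t l m) (at m)"
  unfolding H_def H\<^sub>m_def by (cases "t = 0") (auto intro!: derivative_eq_intros simp: field_simps)

lemma H_partial_l: "((\<lambda>l. H t l m) has_field_derivative H\<^sub>l t l m) (at l)"
  unfolding H_def H\<^sub>l_def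
  by (cases "t = 0") (auto intro!: derivative_eq_intros simp: field_simps power2_eq_square)

lemma hamiltonian_system_on_iff:
  "hamiltonian_system_on H I lam mu \<longleftrightarrow>
    (\<forall>t\<in>I. (lam has_vector_derivative H\<^sub>m t (lam t) (mu t)) (at t) \<and>
           (mu has_vector_derivative - H\<^sub>l t (lam t) (mu t)) (at t))"
  unfolding hamiltonian_system_on_def DERIV_imp_deriv[OF H_partial_m] DERIV_imp_deriv[OF H_partial_l] ..

lemma hamiltonian_function_H: "hamiltonian_function \<sigma> H"
  unfolding hamiltonian_function_def field_differentiable_def
  using H_partial_l H_partial_m by blast

lemma compatibility_function_a: "compatibility_function \<sigma> a"
  unfolding compatibility_function_def
proof (intro allI impI)
  fix t :: real and l m :: complex assume "0 < t"
  then show "\<exists>u v. \<forall>x. poly (\<sigma> t) x \<noteq> 0 \<and> x \<noteq> l \<longrightarrow>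
      poly v x \<noteq> 0 \<and> a t l m x = poly u x / poly v x"
    by (intro exI[of _ "[:0, 0, 1:]"] exI[of _ "[:- (of_real t * l), of_real t:]"])
      (auto simp: a_def power2_eq_square algebra_simps)
qed

lemma compatibility_function_b: "compatibility_function \<sigma> b"
  unfolding compatibility_function_def
proof (intro allI impI)
  fix t :: real and l m :: complex assume "0 < t"
  then show "\<exists>u v. \<forall>x. poly (\<sigma> t) x \<noteq> 0 \<and> x \<noteq> l \<longrightarrow>
      poly v x \<noteq> 0 \<and> b t l m x = poly u x / poly v x"
    by (intro exI[of _ "[:- (m * l\<^sup>2):]"] exI[of _ "[:- (of_real t * l), of_real t:]"])
      (auto simp: b_def algebra_simps)
qed

text \<open>The two compatibility equations as identities between rational functions, with \<open>D\<close> for the distance \<open>x - \<lambda>\<close>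
  from the apparent singularity.  Primed variables stand for \<open>t\<close>-derivatives, so that \<open>- s / 2 - l' / D\<^sup>2\<close> below is
  \<open>P\<^sub>t\<close>.  In the first equation everything cancels except the double pole at \<open>\<lambda>\<close>, whose coefficient is the defect of
  the equation for \<open>\<lambda>'\<close>.\<close>

lemma zero_curvature_phi_x:
  fixes t l' m x D l :: complex
  assumes "t \<noteq> 0" "x \<noteq> 0" "x = l + D" "D \<noteq> 0"
    and "g = s * t / 2"
  shows "2 * (m * l\<^sup>2 / (t * D\<^sup>2)) + 2 * l\<^sup>2 / (t * D ^ 3)
      - (- 2 * s / x ^ 3 - \<beta> / x\<^sup>2 + 1 / D\<^sup>2) * (x\<^sup>2 / (t * D))
      - (s / x\<^sup>2 + \<beta> / x - g - 1 / D) * ((1 - l\<^sup>2 / D\<^sup>2) / t)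
      + (- (s / 2) - l' / D\<^sup>2) =
    ((2 * m * l\<^sup>2 + (s + (\<beta> - 2) * l - g * l\<^sup>2)) / t - l') / D\<^sup>2"
  using assms(1,2,4) unfolding assms(5)
  by (simp add: divide_simps) (simp add: assms(3), algebra)

text \<open>Once \<open>\<lambda>' = V\<close> has its Hamiltonian value, the second equation depends on \<open>\<mu>'\<close> only through \<open>m' - M\<close>, the defect of
  the equation for \<open>\<mu>'\<close>.  Here \<open>c\<close> is \<open>t H\<close>, which is subtracted in the numerator of \<open>Q\<close>, and \<open>W = \<mu> \<lambda>\<^sup>2\<close> is the
  numerator of its pole at \<open>\<lambda>\<close>; \<open>c'\<close> and \<open>W'\<close> are their \<open>t\<close>-derivatives.\<close>

lemma zero_curvature_phi:
  fixes t l' m m' x D l :: complex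
  assumes "t \<noteq> 0" "x \<noteq> 0" "x = l + D" "D \<noteq> 0"
    and "g = s * t / 2"
    and c: "c = m * (s + \<beta> * l - g * l\<^sup>2 - 2 * l) + m\<^sup>2 * l\<^sup>2 + \<nu> * g * l"
    and V: "V = (2 * m * l\<^sup>2 + (s + (\<beta> - 2) * l - g * l\<^sup>2)) / t"
    and M: "M = - ((2 * m\<^sup>2 * l + m * (\<beta> - 2 - 2 * g * l) + \<nu> * g) / t)"
    and c': "c' = m' * (s + \<beta> * l - g * l\<^sup>2 - 2 * l)
      + m * (\<beta> * V - (s / 2) * l\<^sup>2 - 2 * g * l * V - 2 * V)
      + 2 * m * m' * l\<^sup>2 + 2 * m\<^sup>2 * l * V + \<nu> * (s / 2) * l + \<nu> * g * V"
    and W': "W' = m' * l\<^sup>2 + 2 * m * l * V"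
  shows "- 2 * (m * l\<^sup>2) / (t * D ^ 3)
      - ((\<nu> * g - m * l\<^sup>2 / D\<^sup>2) / x\<^sup>2 - 2 * (\<nu> * g * x - c + m * l\<^sup>2 / D) / x ^ 3) * (x\<^sup>2 / (t * D))
      - 2 * ((\<nu> * g * x - c + m * l\<^sup>2 / D) / x\<^sup>2) * ((1 - l\<^sup>2 / D\<^sup>2) / t)
      + (s / x\<^sup>2 + \<beta> / x - g - 1 / D) * (m * l\<^sup>2 / (t * D\<^sup>2))
      + (\<nu> * (s / 2) * x - c' + W' / D + m * l\<^sup>2 * V / D\<^sup>2) / x\<^sup>2 =
    (m' - M) * (l\<^sup>2 - t * V * D) / (x\<^sup>2 * D)"
  using assms(1,2,4) unfolding c' W' c V M assms(5)
  by (simp add: divide_simps) (simp add: assms(3), algebra)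


lemma deformed_P_eq:
  "x \<noteq> 0 \<Longrightarrow> deformed_P \<sigma> \<tau> t l x = s / x\<^sup>2 + \<beta> / x - \<gamma> t - 1 / (x - l)"
  by (cases "x = l") (simp_all add: deformed_P_def field_simps power2_eq_square)

lemma deformed_Q_eq:
  "deformed_Q \<sigma> \<tau> \<eta> t l m x =
    (\<nu> * \<gamma> t * x - (m * (s + \<beta> * l - \<gamma> t * l\<^sup>2 - 2 * l) + m\<^sup>2 * l\<^sup>2 + \<nu> * \<gamma> t * l)
      + m * l\<^sup>2 / (x - l)) / x\<^sup>2"
  by (simp add: deformed_Q_def)

text \<open>After the derivatives have been computed, the two identities above reduce compatibility to the vanishing of the two
  defects, the second one multiplied by the factor \<open>\<lambda>\<^sup>2 - t \<lambda>' (x - \<lambda>)\<close>.\<close>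

lemma compatible_iff_hamilton_equations:
  assumes t: "t > 0" and l: "lam t \<noteq> 0"
    and lam: "(lam has_vector_derivative l') (at t)"
    and mu: "(mu has_vector_derivative m') (at t)"
  shows "compatible_at (\<lambda>s. deformed_P \<sigma> \<tau> s (lam s)) (\<lambda>s. deformed_Q \<sigma> \<tau> \<eta> s (lam s) (mu s))
      (a t (lam t) (mu t)) (b t (lam t) (mu t)) t {x. poly (\<sigma> t) x \<noteq> 0 \<and> x \<noteq> lam t} \<longleftrightarrow>
    l' = H\<^sub>m t (lam t) (mu t) \<and> m' = - H\<^sub>l t (lam t) (mu t)"
    (is "?compatible \<longleftrightarrow> _")
proof -
  define l m T where "l = lam t" and "m = mu t" and "T = complex_of_real t"
  define g where "g = s * T / 2"
  define c where "c = m * (s + \<beta> * l - g * l\<^sup>2 - 2 * l) + m\<^sup>2 * l\<^sup>2 + \<nu> * g * l"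
  define c' where "c' = m' * (s + \<beta> * l - g * l\<^sup>2 - 2 * l)
      + m * (\<beta> * l' - (s / 2) * l\<^sup>2 - 2 * g * l * l' - 2 * l')
      + 2 * m * m' * l\<^sup>2 + 2 * m\<^sup>2 * l * l' + \<nu> * (s / 2) * l + \<nu> * g * l'"
  define W' where "W' = m' * l\<^sup>2 + 2 * m * l * l'"
  define S where "S = {x. x \<noteq> 0 \<and> x \<noteq> l}"
  have T: "T \<noteq> 0" and l0: "l \<noteq> 0"
    using t l by (auto simp: T_def l_def)
  have "S = - {0, l}"
    by (auto simp: S_def)
  then have "open S"
    by (simp add: open_Compl)
  have S_eq: "{x. poly (\<sigma> t) x \<noteq> 0 \<and> x \<noteq> lam t} = S"
    by (auto simp: S_def l_def)
  have "?compatible \<longleftrightarrow> (\<forall>x\<in>S.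
      2 * (m * l\<^sup>2 / (T * (x - l)\<^sup>2)) + 2 * l\<^sup>2 / (T * (x - l) ^ 3)
        - (- 2 * s / x ^ 3 - \<beta> / x\<^sup>2 + 1 / (x - l)\<^sup>2) * a t (lam t) (mu t) x
        - deformed_P \<sigma> \<tau> t (lam t) x * ((1 - l\<^sup>2 / (x - l)\<^sup>2) / T)
        + (- (s / 2) - l' / (x - l)\<^sup>2) = 0 \<and>
      - 2 * (m * l\<^sup>2) / (T * (x - l) ^ 3)
        - ((\<nu> * g - m * l\<^sup>2 / (x - l)\<^sup>2) / x\<^sup>2
            - 2 * (\<nu> * g * x - c + m * l\<^sup>2 / (x - l)) / x ^ 3) * a t (lam t) (mu t) x
        - 2 * deformed_Q \<sigma> \<tau> \<eta> t (lam t) (mu t) x * ((1 - l\<^sup>2 / (x - l)\<^sup>2) / T)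
        + deformed_P \<sigma> \<tau> t (lam t) x * (m * l\<^sup>2 / (T * (x - l)\<^sup>2))
        + (\<nu> * (s / 2) * x - c' + W' / (x - l) + m * l\<^sup>2 * l' / (x - l)\<^sup>2) / x\<^sup>2 = 0)"
    (is "_ \<longleftrightarrow> Ball S ?lhs")
    unfolding S_eq
  proof (rule compatible_at_iff[OF \<open>open S\<close>])
    fix x assume "x \<in> S"
    then have x: "x \<noteq> 0" "x \<noteq> l" "l \<noteq> x"
      by (auto simp: S_def)
    show "(a t (lam t) (mu t) has_field_derivative (1 - l\<^sup>2 / (x - l)\<^sup>2) / T) (at x)"
      unfolding a_def T_def[symmetric] l_def[symmetric]
      by (auto intro!: derivative_eq_intros simp: x T) (simp add: divide_simps x T, algebra)
    show "((\<lambda>x. (1 - l\<^sup>2 / (x - l)\<^sup>2) / T) has_field_derivative 2 * l\<^sup>2 / (T * (x - l) ^ 3)) (at x)"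
      by (auto intro!: derivative_eq_intros simp: x T) (simp add: divide_simps x T, algebra)
    show "(b t (lam t) (mu t) has_field_derivative m * l\<^sup>2 / (T * (x - l)\<^sup>2)) (at x)"
      unfolding b_def T_def[symmetric] l_def[symmetric] m_def[symmetric]
      by (auto intro!: derivative_eq_intros simp: x T)
        (simp add: divide_simps x T power2_eq_square)
    show "((\<lambda>x. m * l\<^sup>2 / (T * (x - l)\<^sup>2)) has_field_derivative
        - 2 * (m * l\<^sup>2) / (T * (x - l) ^ 3)) (at x)"
      by (auto intro!: derivative_eq_intros simp: x T) (simp add: divide_simps x T, algebra)
    show "(deformed_P \<sigma> \<tau> t (lam t) has_field_derivative
        - 2 * s / x ^ 3 - \<beta> / x\<^sup>2 + 1 / (x - l)\<^sup>2) (at x)"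
    proof (rule has_field_derivative_transform_within_open[OF _ \<open>open S\<close> \<open>x \<in> S\<close>])
      show "((\<lambda>x. s / x\<^sup>2 + \<beta> / x - \<gamma> t - 1 / (x - l)) has_field_derivative
          - 2 * s / x ^ 3 - \<beta> / x\<^sup>2 + 1 / (x - l)\<^sup>2) (at x)"
        by (auto intro!: derivative_eq_intros simp: x T) (simp add: divide_simps x T, algebra)
    qed (auto simp: S_def deformed_P_eq l_def)
    have nonzero: "x\<^sup>2 \<noteq> 0" "x - lam t \<noteq> 0" "(2::complex) \<noteq> 0"
      using x by (auto simp: l_def)
    show "((\<lambda>u. deformed_P \<sigma> \<tau> u (lam u) x) has_vector_derivative
        - (s / 2) - l' / (x - l)\<^sup>2) (at t)"
      unfolding deformed_P_eq[OF x(1)]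
      apply (rule has_vector_derivative_eq_rhs)
       apply (rule vector_derivative_rules lam x(1) nonzero)+
      by (simp add: x l_def[symmetric] power2_eq_square)
    show "(deformed_Q \<sigma> \<tau> \<eta> t (lam t) (mu t) has_field_derivative
        (\<nu> * g - m * l\<^sup>2 / (x - l)\<^sup>2) / x\<^sup>2
            - 2 * (\<nu> * g * x - c + m * l\<^sup>2 / (x - l)) / x ^ 3) (at x)"
      unfolding deformed_Q_eq T_def[symmetric] l_def[symmetric] m_def[symmetric]
        g_def[symmetric] c_def[symmetric]
      by (auto intro!: derivative_eq_intros simp: x T) (simp add: divide_simps x T, algebra)
    show "((\<lambda>u. deformed_Q \<sigma> \<tau> \<eta> u (lam u) (mu u) x) has_vector_derivative
        (\<nu> * (s / 2) * x - c' + W' / (x - l) + m * l\<^sup>2 * l' / (x - l)\<^sup>2) / x\<^sup>2) (at t)"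
      unfolding deformed_Q_eq
      apply (rule has_vector_derivative_eq_rhs)
       apply (rule vector_derivative_rules lam mu x(1) nonzero)+
      apply (simp add: x l_def[symmetric] m_def[symmetric] T_def[symmetric] c'_def W'_def g_def)
      by (simp add: divide_simps x) algebra
  qed
  also have "\<dots> \<longleftrightarrow> (\<forall>x\<in>S. l' = H\<^sub>m t l m \<and> (m' + H\<^sub>l t l m) * (l\<^sup>2 - T * l' * (x - l)) = 0)"
  proof (rule ball_cong[OF refl])
    fix x assume "x \<in> S"
    then have x: "x \<noteq> 0" "x - l \<noteq> 0" and xl: "x = l + (x - l)"
      by (auto simp: S_def)
    let ?M = "- H\<^sub>l t l m"
    have M: "?M = - ((2 * m\<^sup>2 * l + m * (\<beta> - 2 - 2 * g * l) + \<nu> * g) / T)"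
      by (simp add: H\<^sub>l_def g_def T_def)
    have V: "H\<^sub>m t l m = (2 * m * l\<^sup>2 + (s + (\<beta> - 2) * l - g * l\<^sup>2)) / T"
      by (simp add: H\<^sub>m_def g_def T_def)
    have P: "deformed_P \<sigma> \<tau> t (lam t) x = s / x\<^sup>2 + \<beta> / x - g - 1 / (x - l)"
      using x by (simp add: deformed_P_eq g_def T_def l_def)
    have Q: "deformed_Q \<sigma> \<tau> \<eta> t (lam t) (mu t) x = (\<nu> * g * x - c + m * l\<^sup>2 / (x - l)) / x\<^sup>2"
      by (simp add: deformed_Q_eq g_def T_def l_def m_def c_def)
    have a: "a t (lam t) (mu t) x = x\<^sup>2 / (T * (x - l))"
      by (simp add: a_def T_def l_def)
    note first = zero_curvature_phi_x[OF T x(1) xl x(2) g_def, of m l', folded V]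
    note second = zero_curvature_phi[OF T x(1) xl x(2) g_def c_def _ M c'_def W'_def]
    show "?lhs x \<longleftrightarrow> l' = H\<^sub>m t l m \<and> (m' + H\<^sub>l t l m) * (l\<^sup>2 - T * l' * (x - l)) = 0"
    proof (cases "l' = H\<^sub>m t l m")
      case True
      show ?thesis
        unfolding P Q a first second[OF True[unfolded V]] using x True by simp
    next
      case False
      then show ?thesis
        unfolding P Q a first using x by simp
    qed
  qed
  also have "\<dots> \<longleftrightarrow> l' = H\<^sub>m t l m \<and> m' = - H\<^sub>l t l m"
  proof safe
    assume all: "\<forall>x\<in>S. l' = H\<^sub>m t l m \<and> (m' + H\<^sub>l t l m) * (l\<^sup>2 - T * l' * (x - l)) = 0"
    \<comment> \<open>The factor is affine in \<open>x\<close> with value \<open>l\<^sup>2 \<noteq> 0\<close> at \<open>x = l\<close>, hence it has at most one zero, and any two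
        points of \<open>S\<close> will do; \<open>2 * l\<close> and \<open>3 * l\<close> avoid both singular points.\<close>
    have S: "2 * l \<in> S" "3 * l \<in> S"
      using l0 by (auto simp: S_def)
    show "l' = H\<^sub>m t l m"
      using all S by blast
    have "m' + H\<^sub>l t l m = 0"
    proof (rule ccontr)
      assume "m' + H\<^sub>l t l m \<noteq> 0"
      then have "l\<^sup>2 - T * l' * (2 * l - l) = 0" "l\<^sup>2 - T * l' * (3 * l - l) = 0"
        using all S by (metis mult_eq_0_iff)+
      then have "l\<^sup>2 = 0"
        by algebra
      then show False
        using l0 by simp
    qed
    then show "m' = - H\<^sub>l t l m"
      by (simp add: eq_neg_iff_add_eq_0)
  qed auto
  finally show ?thesis
    by (simp add: l_def m_def)
qed


text \<open>Derivatives of \<open>lam\<close> and \<open>mu\<close> are unique, so the values forced by compatibility are the ones prescribed by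
  the Hamiltonian system.\<close>

lemma isomonodromic_on_iff_hamiltonian_system_on:
  assumes adm: "admissible_on \<sigma> I lam"
    and diff: "\<forall>t\<in>I. lam differentiable (at t) \<and> mu differentiable (at t)"
  shows "isomonodromic_on \<sigma> \<tau> \<eta> a b I lam mu \<longleftrightarrow> hamiltonian_system_on H I lam mu"
  unfolding isomonodromic_on_def hamiltonian_system_on_iff
proof (intro ball_cong refl)
  fix t assume "t \<in> I"
  then have t: "t > 0" and l: "lam t \<noteq> 0"
    using adm by (auto simp: admissible_on_def)
  obtain l' m' where lam: "(lam has_vector_derivative l') (at t)"
    and mu: "(mu has_vector_derivative m') (at t)"
    using diff \<open>t \<in> I\<close> vector_derivative_works by blast
  have unique: "(f has_vector_derivative d) (at t) \<Longrightarrow> (f has_vector_derivative e) (at t) \<longleftrightarrow> d = e"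
    for f :: "real \<Rightarrow> complex" and d e
    using vector_derivative_unique_at by blast
  show "compatible_at (\<lambda>s. deformed_P \<sigma> \<tau> s (lam s)) (\<lambda>s. deformed_Q \<sigma> \<tau> \<eta> s (lam s) (mu s))
      (a t (lam t) (mu t)) (b t (lam t) (mu t)) t {x. poly (\<sigma> t) x \<noteq> 0 \<and> x \<noteq> lam t} \<longleftrightarrow>
    (lam has_vector_derivative H\<^sub>m t (lam t) (mu t)) (at t) \<and>
    (mu has_vector_derivative - H\<^sub>l t (lam t) (mu t)) (at t)"
    unfolding compatible_iff_hamilton_equations[OF t l lam mu] unique[OF lam] unique[OF mu] ..
qed

section \<open>Elimination of the momentum\<close>

text \<open>With \<open>u = \<lambda> \<mu>\<close> and \<open>\<theta> = t d/dt\<close>, Hamilton's equations give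
  \<open>\<theta>\<^sup>2 log \<lambda> = - (2 \<nu> + 1) \<gamma> \<lambda> + (s / \<lambda> + \<gamma> \<lambda>) (2 u - \<theta> log \<lambda>)\<close>, and the momentum drops out because
  \<open>2 u - \<theta> log \<lambda> = \<gamma> \<lambda> - s / \<lambda> + 2 - \<beta>\<close>.\<close>

lemma velocity_derivative:
  assumes "t > 0" "lam t \<noteq> 0"
    and lam: "(lam has_vector_derivative H\<^sub>m t (lam t) (mu t)) (at t)"
    and mu: "(mu has_vector_derivative - H\<^sub>l t (lam t) (mu t)) (at t)"
  shows "((\<lambda>t. H\<^sub>m t (lam t) (mu t)) has_vector_derivative R t (lam t) (H\<^sub>m t (lam t) (mu t))) (at t)"
proof -
  define l m T where "l = lam t" and "m = mu t" and "T = complex_of_real t"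
  have nz: "T \<noteq> 0" "l \<noteq> 0"
    using assms by (auto simp: l_def T_def)
  have nonzero: "complex_of_real t \<noteq> 0" "(2::complex) \<noteq> 0"
    using assms by auto
  show ?thesis
    unfolding H\<^sub>m_def
    apply (rule has_vector_derivative_eq_rhs)
     apply (rule vector_derivative_rules lam mu nonzero)+
    apply (simp only: H\<^sub>m_def H\<^sub>l_def R_def l_def[symmetric] m_def[symmetric] T_def[symmetric])
    by (simp add: divide_simps nz) algebra
qed

text \<open>Conversely, solving \<open>\<lambda>' = H\<^sub>m\<close> for the momentum is possible because the coefficient \<open>2 \<lambda>\<^sup>2 / t\<close> of \<open>\<mu>\<close> does not
  vanish, and then the second order equation for \<open>\<lambda>\<close> amounts to \<open>\<mu>' = - H\<^sub>l\<close>.\<close>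

lemma momentum_from_velocity:
  assumes "t > 0" "lam t \<noteq> 0"
    and lam: "(lam has_vector_derivative p t) (at t)"
    and p: "(p has_vector_derivative R t (lam t) (p t)) (at t)"
    and mu: "mu = (\<lambda>t. (of_real t * p t - (s + (\<beta> - 2) * lam t - \<gamma> t * (lam t)\<^sup>2)) / (2 * (lam t)\<^sup>2))"
  shows "H\<^sub>m t (lam t) (mu t) = p t"
    and "(mu has_vector_derivative - H\<^sub>l t (lam t) (mu t)) (at t)"
proof -
  define l v T where "l = lam t" and "v = p t" and "T = complex_of_real t"
  have nz: "T \<noteq> 0" "l \<noteq> 0"
    using assms by (auto simp: l_def T_def)
  show "H\<^sub>m t (lam t) (mu t) = p t"
    using nz by (simp add: H\<^sub>m_def mu l_def T_def field_simps)
  have nonzero: "2 * (lam t)\<^sup>2 \<noteq> 0" "(2::complex) \<noteq> 0"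
    using assms by auto
  show "(mu has_vector_derivative - H\<^sub>l t (lam t) (mu t)) (at t)"
    unfolding mu
    apply (rule has_vector_derivative_eq_rhs)
     apply (rule vector_derivative_rules lam p nonzero)+
    apply (simp only: H\<^sub>l_def R_def l_def[symmetric] v_def[symmetric] T_def[symmetric])
    by (simp add: divide_simps nz) algebra
qed

lemma hamiltonian_system_on_iff_second_order:
  assumes "admissible_on \<sigma> I lam"
  shows "(\<exists>mu. hamiltonian_system_on H I lam mu) \<longleftrightarrow> solves_second_order_on R I lam"
proof
  have adm: "t > 0" "lam t \<noteq> 0" if "t \<in> I" for t
    using assms that by (auto simp: admissible_on_def)
  {
    assume "\<exists>mu. hamiltonian_system_on H I lam mu"
    then obtain mu where "\<forall>t\<in>I. (lam has_vector_derivative H\<^sub>m t (lam t) (mu t)) (at t) \<and>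
        (mu has_vector_derivative - H\<^sub>l t (lam t) (mu t)) (at t)"
      unfolding hamiltonian_system_on_iff ..
    then show "solves_second_order_on R I lam"
      unfolding solves_second_order_on_def
      using velocity_derivative[where lam = lam and mu = mu] adm
      by (intro exI[of _ "\<lambda>t. H\<^sub>m t (lam t) (mu t)"]) blast
  next
    assume "solves_second_order_on R I lam"
    then obtain p where p: "\<forall>t\<in>I. (lam has_vector_derivative p t) (at t) \<and>
        (p has_vector_derivative R t (lam t) (p t)) (at t)"
      unfolding solves_second_order_on_def by blast
    define mu where
      "mu = (\<lambda>t. (of_real t * p t - (s + (\<beta> - 2) * lam t - \<gamma> t * (lam t)\<^sup>2)) / (2 * (lam t)\<^sup>2))"
    show "\<exists>mu. hamiltonian_system_on H I lam mu"
      unfolding hamiltonian_system_on_iff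
      using momentum_from_velocity[where lam = lam and p = p, OF _ _ _ _ mu_def] adm p
      by (intro exI[of _ mu]) auto
  }
qed

section \<open>The change of variables\<close>

lemma change_of_variables_scaling:
  "change_of_variables \<sigma> (\<lambda>t. t) (\<lambda>t l. of_real t * l)"
  unfolding change_of_variables_def
proof (intro conjI allI impI)
  show "bij_betw (\<lambda>t::real. t) {0<..} {0<..}"
    by (simp add: bij_betw_def)
  show "\<exists>d. d \<noteq> 0 \<and> ((\<lambda>t. t) has_real_derivative d) (at t)" for t :: real
    by (intro exI[of _ 1]) simp
  show "(\<lambda>(t, l). complex_of_real t * l) differentiable_on {(t, l). t > 0 \<and> poly (\<sigma> t) l \<noteq> 0}"
    unfolding differentiable_on_def case_prod_beta
    by (intro ballI differentiable_mult)
      (auto intro!: bounded_linear_imp_differentiable bounded_linear_compose[OF bounded_linear_of_real]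
        bounded_linear_fst bounded_linear_snd)
  fix t :: real assume t: "t > 0"
  show "(\<lambda>l. complex_of_real t * l) holomorphic_on {l. poly (\<sigma> t) l \<noteq> 0}"
    by (intro holomorphic_intros)
  show "bij_betw (\<lambda>l. complex_of_real t * l) {l. poly (\<sigma> t) l \<noteq> 0} (- {0})"
    using t by (intro bij_betw_byWitness[where f' = "\<lambda>y. y / of_real t"]) auto
qed

text \<open>The key is the pointwise identity \<open>rhs\<close> between right-hand sides: for \<open>y = t \<lambda>\<close> one has \<open>y' = \<lambda> + t \<lambda>'\<close> and
  \<open>y'' = 2 \<lambda>' + t \<lambda>''\<close>.  Both directions transport the derivatives through \<open>y = t \<lambda>\<close> and \<open>\<lambda> = y / t\<close>, which hold
  on a neighbourhood of each point of the open set \<open>I\<close>.\<close>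

lemma second_order_iff_painleve_III':
  assumes adm: "admissible_on \<sigma> I lam" and y: "\<forall>t\<in>I. y t = of_real t * lam t"
  shows "solves_second_order_on R I lam \<longleftrightarrow>
    painleve_III'_on (2 * s * (1 - \<beta> - 2 * \<nu>)) (4 * s * (2 - \<beta>)) (s\<^sup>2) (- 4 * s\<^sup>2) I y"
    (is "_ \<longleftrightarrow> painleve_III'_on ?A ?B ?C ?D I y")
proof -
  have "open I" and pos: "\<And>t. t \<in> I \<Longrightarrow> t > 0" and l0: "\<And>t. t \<in> I \<Longrightarrow> lam t \<noteq> 0"
    using adm by (auto simp: admissible_on_def)
  let ?R = "\<lambda>t y y'. y'\<^sup>2 / y - y' / of_real t + ?A * y\<^sup>2 / (4 * (of_real t)\<^sup>2) + ?B / (4 * of_real t)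
          + ?C * y ^ 3 / (4 * (of_real t)\<^sup>2) + ?D / (4 * y)"
  have rhs: "?R t (of_real t * l) (l + of_real t * p) = 2 * p + of_real t * R t l p"
    if "t > 0" "l \<noteq> 0" for t l p
  proof -
    define T where "T = complex_of_real t"
    have "T \<noteq> 0"
      using that by (simp add: T_def)
    then show ?thesis
      unfolding R_def T_def[symmetric]
      by (simp add: divide_simps that) algebra
  qed
  have y0: "y t \<noteq> 0" if "t \<in> I" for t
    using y l0 pos that by force
  have "solves_second_order_on R I lam \<longleftrightarrow> solves_second_order_on ?R I y"
  proof
    assume "solves_second_order_on R I lam"
    then obtain p where p: "\<And>t. t \<in> I \<Longrightarrow> (lam has_vector_derivative p t) (at t)"
        "\<And>t. t \<in> I \<Longrightarrow> (p has_vector_derivative R t (lam t) (p t)) (at t)"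
      unfolding solves_second_order_on_def by blast
    show "solves_second_order_on ?R I y"
      unfolding solves_second_order_on_def
    proof (intro exI ballI conjI)
      fix t assume t: "t \<in> I"
      show "(y has_vector_derivative lam t + of_real t * p t) (at t)"
      proof (rule has_vector_derivative_transform_within_open[OF _ \<open>open I\<close> t])
        show "((\<lambda>t. of_real t * lam t) has_vector_derivative lam t + of_real t * p t) (at t)"
          by (rule has_vector_derivative_eq_rhs, (rule vector_derivative_rules p t)+) simp
      qed (simp add: y)
      have "((\<lambda>t. lam t + of_real t * p t) has_vector_derivative
          2 * p t + of_real t * R t (lam t) (p t)) (at t)"
        by (rule has_vector_derivative_eq_rhs, (rule vector_derivative_rules p t)+) simp
      then show "((\<lambda>t. lam t + of_real t * p t) has_vector_derivative
          ?R t (y t) (lam t + of_real t * p t)) (at t)"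
        using rhs[OF pos[OF t] l0[OF t]] y t by simp
    qed
  next
    assume "solves_second_order_on ?R I y"
    then obtain v where v: "\<And>t. t \<in> I \<Longrightarrow> (y has_vector_derivative v t) (at t)"
        "\<And>t. t \<in> I \<Longrightarrow> (v has_vector_derivative ?R t (y t) (v t)) (at t)"
      unfolding solves_second_order_on_def by blast
    define p where "p = (\<lambda>t. (v t - y t / of_real t) / of_real t)"
    show "solves_second_order_on R I lam"
      unfolding solves_second_order_on_def
    proof (intro exI ballI conjI)
      fix t assume t: "t \<in> I"
      have T0: "complex_of_real t \<noteq> 0"
        using pos[OF t] by simp
      show "(lam has_vector_derivative p t) (at t)"
      proof (rule has_vector_derivative_transform_within_open[OF _ \<open>open I\<close> t])
        show "((\<lambda>t. y t / of_real t) has_vector_derivative p t) (at t)"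
          by (rule has_vector_derivative_eq_rhs, (rule vector_derivative_rules v t T0)+)
            (simp add: p_def divide_simps T0 power2_eq_square)
      qed (use y pos in force)
      have yt: "y t = of_real t * lam t" and vt: "v t = lam t + of_real t * p t"
        using y t T0 by (simp_all add: p_def)
      have v': "(v has_vector_derivative 2 * p t + of_real t * R t (lam t) (p t)) (at t)"
        using v(2)[OF t] unfolding yt vt rhs[OF pos[OF t] l0[OF t]] .
      show "(p has_vector_derivative R t (lam t) (p t)) (at t)"
        unfolding p_def
        apply (rule has_vector_derivative_eq_rhs)
         apply (rule vector_derivative_rules v' v(1) t T0)+
        using pos[OF t] by (simp add: yt vt field_simps power2_eq_square)
    qed
  qed
  then show ?thesis
    using y0 by (simp add: painleve_III'_on_def)
qed

section \<open>The double-confluent Heun equation\<close>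

lemma transforms_to_painleve_III'_double_confluent:
  assumes "polynomial_form p q \<sigma> \<tau> \<eta>"
  shows "transforms_to_painleve_III' p q"
proof -
  \<comment> \<open>Time is not changed, but the image of \<open>I\<close> under the identity has to be matched literally.\<close>
  have painleve: "(\<forall>I lam y. admissible_on \<sigma> I lam \<longrightarrow> (\<forall>t\<in>I. y t = of_real t * lam t) \<longrightarrow>
     (solves_second_order_on R I lam \<longleftrightarrow> painleve_III'_on (2 * s * (1 - \<beta> - 2 * \<nu>))
        (4 * s * (2 - \<beta>)) (s\<^sup>2) (- 4 * s\<^sup>2) ((\<lambda>t. t) ` I) y))"
    using second_order_iff_painleve_III' by simp
  show ?thesis
    unfolding transforms_to_painleve_III'_def
    apply (rule exI[of _ \<sigma>], rule exI[of _ \<tau>], rule exI[of _ \<eta>], rule exI[of _ a], rule exI[of _ b],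
        rule exI[of _ H], rule exI[of _ R], rule exI[of _ "\<lambda>t. t"],
        rule exI[of _ "\<lambda>t l. of_real t * l"], (rule exI)+)
    apply (intro conjI allI impI assms compatibility_function_a compatibility_function_b
        hamiltonian_function_H change_of_variables_scaling)
      apply (rule isomonodromic_on_iff_hamiltonian_system_on, assumption, assumption)
     apply (rule hamiltonian_system_on_iff_second_order, assumption)
    by (rule painleve[rule_format], assumption, blast)
qed

lemma polynomial_form_double_confluent:
  assumes "\<And>t x. t > 0 \<Longrightarrow> x \<noteq> 0 \<Longrightarrow> p t x = s / x\<^sup>2 + \<beta> / x - \<gamma> t"
    and "\<And>t x. t > 0 \<Longrightarrow> x \<noteq> 0 \<Longrightarrow> q t x = \<nu> * \<gamma> t / x"
  shows "polynomial_form p q \<sigma> \<tau> \<eta>"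
  unfolding polynomial_form_def
proof (intro allI impI conjI)
  fix t :: real assume t: "t > 0"
  show "\<sigma> t \<noteq> 0"
    by (simp add: \<sigma>_def)
  show "\<nexists>x. poly (\<sigma> t) x = 0 \<and> poly (\<tau> t) x = 0 \<and> poly (\<eta> t) x = 0"
    using s_nonzero by auto
  fix x assume "poly (\<sigma> t) x \<noteq> 0"
  then have x: "x \<noteq> 0"
    by simp
  show "p t x = poly (\<tau> t) x / poly (\<sigma> t) x" "q t x = poly (\<eta> t) x / poly (\<sigma> t) x"
    using x assms[OF t x] by (simp_all add: field_simps power2_eq_square)
qed

end

theorem theorem3p1:
  fixes n :: nat and \<alpha> :: real
  assumes "n \<ge> 1" and "\<alpha> > 0"
  shows "transforms_to_painleve_III' (heun_p \<alpha>) (heun_q n \<alpha>)"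
proof -
  interpret double_confluent "of_real (sqrt 2)" "of_real ((1 + \<alpha>) / 2)" "of_real ((2 * real n + \<alpha>) / 4)"
    by unfold_locales simp
  show ?thesis
    by (intro transforms_to_painleve_III'_double_confluent polynomial_form_double_confluent)
      (simp_all add: heun_p_def heun_q_def field_simps)
qed

end
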